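(* Let $M=(S,(r_a)_{a\in\mathcal A},\pi)$ be an EGL-model. (i) If $M$ is serial, then $\neg B_a\bot$ is true in $M$ for every $a\in\mathcal A$. (ii) If $M$ is transitive, then $B_a\varphi\to B_aB_a\varphi$ is true in $M$ for every $a\in\mathcal A$ and every formula $\varphi$. (iii) If $M$ is reflexive, then $B_a\varphi\to\varphi$ is true in $M$ for every $a\in\mathcal A$ and every formula $\varphi$.
   Context: Fix a set $\mathcal P$ of atomic propositions and a set $\mathcal A$ of agents. Formulas: $\varphi ::= p \mid \bot \mid \varphi\wedge\varphi \mid \varphi\to\varphi \mid B_a\varphi$ with $p\in\mathcal P$, $a\in\mathcal A$; $\neg\varphi=\varphi\to\bot$. An EGL-model is $M=(S,(r_a)_{a\in\mathcal A},\pi)$ where $S$ is a non-empty countable set, each $r_a:S\times S\to[0,1]$, and $\pi:S\times\mathcal P\to[0,1]$. Values: $V_s(p)=\pi(s,p)$; $V_s(\bot)=0$; $V_s(\varphi\wedge\psi)=\min\{V_s(\varphi),V_s(\psi)\}$; $V_s(\varphi\to\psi)=1$ if $V_s(\varphi)\le V_s(\psi)$ and $=V_s(\psi)$ otherwise; $V_s(B_a\varphi)=\inf_{s'\in S}\max\{1-r_a(s,s'),V_{s'}(\varphi)\}$. $\varphi$ is true in $M$ if $V_s(\varphi)=1$ for all $s\in S$. $M$ is serial if for all $a,s$ there is $s'$ with $r_a(s,s')=1$; reflexive if $r_a(s,s)=1$ for all $a,s$; transitive if $r_a(s,s'')\ge\min\{r_a(s,s'),r_a(s',s'')\}$ for all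 $a,s,s',s''$. *)

theory Defs
  imports Complex_Main "HOL-Library.Countable_Set"
begin

datatype ('p, 'a) fm =
    Atom 'p
  | Bot
  | And "('p, 'a) fm" "('p, 'a) fm"
  | Imp "('p, 'a) fm" "('p, 'a) fm"
  | Bel 'a "('p, 'a) fm"

abbreviation Neg :: "('p, 'a) fm \<Rightarrow> ('p, 'a) fm" where
  "Neg \<phi> \<equiv> Imp \<phi> Bot"

record ('s, 'a, 'p) egl_struct =
  states :: "'s set"
  acc :: "'a \<Rightarrow> 's \<Rightarrow> 's \<Rightarrow> real"
  valuation :: "'s \<Rightarrow> 'p \<Rightarrow> real"

text \<open>The values of \<^const>\<open>acc\<close> and \<^const>\<open>valuation\<close> off the set of states are left
  unconstrained; all notions below only look at arguments in the set of states.\<close>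

definition egl_model :: "('s, 'a, 'p) egl_struct \<Rightarrow> bool" where
  "egl_model M \<longleftrightarrow>
     states M \<noteq> {} \<and> countable (states M) \<and>
     (\<forall>a. \<forall>s\<in>states M. \<forall>s'\<in>states M. acc M a s s' \<in> {0..1}) \<and>
     (\<forall>s\<in>states M. \<forall>p. valuation M s p \<in> {0..1})"

primrec val :: "('s, 'a, 'p) egl_struct \<Rightarrow> ('p, 'a) fm \<Rightarrow> 's \<Rightarrow> real" where
  "val M (Atom p) s = valuation M s p"
| "val M Bot s = 0"
| "val M (And \<phi> \<psi>) s = min (val M \<phi> s) (val M \<psi> s)"
| "val M (Imp \<phi> \<psi>) s = (if val M \<phi> s \<le> val M \<psi> s then 1 else val M \<psi> s)"
| "val M (Bel a \<phi>) s = (INF s'\<in>states M. max (1 - acc M a s s') (val M \<phi> s'))"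

definition true_in :: "('s, 'a, 'p) egl_struct \<Rightarrow> ('p, 'a) fm \<Rightarrow> bool" where
  "true_in M \<phi> \<longleftrightarrow> (\<forall>s\<in>states M. val M \<phi> s = 1)"

definition serial :: "('s, 'a, 'p) egl_struct \<Rightarrow> bool" where
  "serial M \<longleftrightarrow> (\<forall>a. \<forall>s\<in>states M. \<exists>s'\<in>states M. acc M a s s' = 1)"

definition reflexive :: "('s, 'a, 'p) egl_struct \<Rightarrow> bool" where
  "reflexive M \<longleftrightarrow> (\<forall>a. \<forall>s\<in>states M. acc M a s s = 1)"

definition transitive :: "('s, 'a, 'p) egl_struct \<Rightarrow> bool" where
  "transitive M \<longleftrightarrow>
     (\<forall>a. \<forall>s\<in>states M. \<forall>s'\<in>states M. \<forall>s''\<in>states M.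
        acc M a s s'' \<ge> min (acc M a s s') (acc M a s' s''))"

end

theory Submission
  imports Defs
begin

text \<open>A Goedel implication has value 1 as soon as its antecedent's value is at most its
  consequent's, so each axiom reduces to a pointwise inequality (\<open>true_in_ImpI\<close>).
  Belief is an infimum, handled through \<open>val_Bel_le\<close> and
  \<open>val_Bel_greatest\<close>. Testing it at a fully accessible state, supplied by seriality or
  reflexivity, removes the accessibility term; transitivity compares the infima at two
  states.\<close>

lemma acc_le_1: "egl_model M \<Longrightarrow> s \<in> states M \<Longrightarrow> s' \<in> states M \<Longrightarrow> acc M a s s' \<le> 1"
  by (auto simp: egl_model_def)

lemma val_Bel_le:
  assumes "egl_model M" "s \<in> states M" "s' \<in> states M"
  shows "val M (Bel a \<phi>) s \<le> max (1 - acc M a s s') (val M \<phi> s')"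
proof -
  \<comment> \<open>A real infimum is a lower bound only for a set bounded below; here the component
    \<open>1 - acc M a s s'\<close> \<ge> 0 supplies the bound.\<close>
  have "bdd_below ((\<lambda>s'. max (1 - acc M a s s') (val M \<phi> s')) ` states M)"
    using acc_le_1[OF assms(1,2)] by (intro bdd_belowI2[where m = 0]) (simp add: le_max_iff_disj)
  then show ?thesis
    using assms(3) unfolding val.simps by (rule cINF_lower)
qed

lemma val_Bel_greatest:
  assumes "egl_model M"
    and "\<And>s'. s' \<in> states M \<Longrightarrow> c \<le> max (1 - acc M a s s') (val M \<phi> s')"
  shows "c \<le> val M (Bel a \<phi>) s"
  using assms unfolding val.simps egl_model_def by (intro cINF_greatest) auto

lemma true_in_ImpI:
  "(\<And>s. s \<in> states M \<Longrightarrow> val M \<phi> s \<le> val M \<psi> s) \<Longrightarrow> true_in M (Imp \<phi> \<psi>)"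
  by (simp add: true_in_def)

lemma serial_true_in:
  assumes "egl_model M" "serial M"
  shows "true_in M (Neg (Bel a Bot))"
proof (rule true_in_ImpI)
  fix s assume s: "s \<in> states M"
  then obtain s' where "s' \<in> states M" "acc M a s s' = 1"
    using assms(2) by (auto simp: serial_def)
  then show "val M (Bel a Bot) s \<le> val M Bot s"
    using val_Bel_le[OF assms(1) s, of s' a Bot] by simp
qed

lemma transitive_true_in:
  assumes "egl_model M" "transitive M"
  shows "true_in M (Imp (Bel a \<phi>) (Bel a (Bel a \<phi>)))"
proof (intro true_in_ImpI val_Bel_greatest[OF assms(1)])
  fix s s' assume s: "s \<in> states M" "s' \<in> states M"
  show "val M (Bel a \<phi>) s \<le> max (1 - acc M a s s') (val M (Bel a \<phi>) s')"
  proof (cases "val M (Bel a \<phi>) s \<le> 1 - acc M a s s'")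
    case False
    have "val M (Bel a \<phi>) s \<le> val M (Bel a \<phi>) s'"
    proof (rule val_Bel_greatest[OF assms(1)])
      fix s'' assume s'': "s'' \<in> states M"
      \<comment> \<open>Complementing turns this into \<open>1 - acc M a s s''\<close> \<le>
        \<open>max (1 - acc M a s s') (1 - acc M a s' s'')\<close>. The case assumption rules out
        \<open>1 - acc M a s s'\<close> as an upper bound for the belief at
        \<open>s\<close>.\<close>
      have "min (acc M a s s') (acc M a s' s'') \<le> acc M a s s''"
        using assms(2) s s'' by (simp add: transitive_def)
      then show "val M (Bel a \<phi>) s \<le> max (1 - acc M a s' s'') (val M \<phi> s'')"
        using val_Bel_le[OF assms(1) s(1) s'', of a \<phi>] False by linarith
    qed
    then show ?thesis by simp
  qed simp
qed

lemma reflexive_true_in: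
  assumes "egl_model M" "reflexive M"
  shows "true_in M (Imp (Bel a \<phi>) \<phi>)"
proof (rule true_in_ImpI)
  fix s assume s: "s \<in> states M"
  \<comment> \<open>Reflexivity gives only the bound \<open>max 0 (val M \<phi> s)\<close>;
    nonnegativity reduces it to \<open>val M \<phi> s\<close>. The state varies in the induction
    because belief looks at other states.\<close>
  have "0 \<le> val M \<phi> s"
    using s
  proof (induction \<phi> arbitrary: s)
    case (Bel b \<phi>)
    then show ?case
      by (intro val_Bel_greatest[OF assms(1)]) (simp add: le_max_iff_disj)
  qed (use assms(1) in \<open>auto simp: egl_model_def\<close>)
  then show "val M (Bel a \<phi>) s \<le> val M \<phi> s"
    using val_Bel_le[OF assms(1) s s, of a \<phi>] assms(2) s by (simp add: reflexive_def)
qed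

theorem lemma2p1:
  fixes M :: "('s, 'a, 'p) egl_struct"
  assumes "egl_model M"
  shows "(serial M \<longrightarrow> (\<forall>a. true_in M (Neg (Bel a Bot)))) \<and>
         (transitive M \<longrightarrow> (\<forall>a \<phi>. true_in M (Imp (Bel a \<phi>) (Bel a (Bel a \<phi>))))) \<and>
         (reflexive M \<longrightarrow> (\<forall>a \<phi>. true_in M (Imp (Bel a \<phi>) \<phi>)))"
  using assms by (simp add: serial_true_in transitive_true_in reflexive_true_in del: val.simps)

end
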